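(* Let $r > k \ge 2$ be integers and let $F$ be a $k$-graph. Then there exists $n_0$ such that for all $n \ge n_0$ the following holds. Suppose that $\chi\colon K_{n}^{r} \to \mathbb{N}$ is a rainbow-$H_{F}^{r}$-free coloring. Then every rainbow subgraph $\mathcal{H} \subseteq K_{n}^{r}$ can be made $H_{F_{-}}^{r}$-free by removing at most $\left(|F|-1\right)\cdot \mathrm{ex}\left(n, \mathrm{Split}(F)\right)$ edges. In particular, \[ \mathrm{ar}(n, H_{F}^{r}) \le \mathrm{ex}(n, H_{F_{-}}^{r}) + \left(|F|-1\right)\cdot \mathrm{ex}\left(n, \mathrm{Split}(F)\right) +1. \]
   Context: An $r$-graph is a collection of $r$-subsets (edges) of a finite vertex set; it is identified with its edge set, and $|F|$ is its number of edges. $K_n^r$ is the complete $r$-graph on $[n]$. For a family $\mathcal{F}$ of $r$-graphs, an $r$-graph is $\mathcal{F}$-free if it contains no member of $\mathcal{F}$ as a subgraph, and $\mathrm{ex}(n,\mathcal{F})$ is the maximum number of edges of an $\mathcal{F}$-free $r$-graph on $n$ vertices. Given a coloring $\chi\colon K_n^r\to\mathbb{N}$, a subgraph is rainbow if no two of its edges receive the same color; $\chi$ is rainbow-$\mathcal{F}$-free if every rainbow subgraph of $K_n^r$ is $\mathcal{F}$-free. The anti-Ramsey number $\mathrm{ar}(n,F)$ is the minimum $m$ such that every surjective map $\chi\colon K_n^r\to[m]$ contains a rainbow copy of $F$. For $r>k$ and a $k$-graph $F$, the expansion $H_F^r$ is the $r$-graph obtained from $F$ by adding to each edge a set of $r-k$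 new vertices, with different edges receiving disjoint new sets; for a family $\mathcal{F}$ of $k$-graphs, $H_{\mathcal{F}}^r=\{H_G^r: G\in\mathcal{F}\}$. $F_-$ is the family of $k$-graphs obtained from $F$ by removing exactly one edge. Splitting: for a $k$-graph $F$ and vertex $u$ with link $L_F(u)=\{e\in\binom{V(F)}{k-1}: e\cup\{u\}\in F\}$ and degree $d_F(u)=|L_F(u)|$, the $u$-splitting is $F\vee u := \{e\cup\{v_e\}: e\in L_F(u)\}\cup (F-u)$, where $F-u$ is $F$ with $u$ and all edges containing $u$ removed and $\{v_e: e\in L_F(u)\}$ is a set of $d_F(u)$ new vertices. For an independent set $I=\{u_1,\dots,u_\ell\}$ of $F$ (possibly empty), $F\vee I$ is obtained by successively splitting $u_1,\dots,u_\ell$ (the order does not matter). $\mathrm{Split}(F)=\{F\vee I: I \text{ an independent set of } F\}$, a family of $k$-graphs (containing $F$). *)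

theory Defs
  imports Complex_Main "HOL-Library.Infinite_Typeclass"
begin

text \<open>
  A hypergraph is identified with its edge set, so its vertex set is the union of its edges.
\<close>

definition ugraph :: "nat \<Rightarrow> 'a set set \<Rightarrow> bool" where
  "ugraph k F \<longleftrightarrow> finite (\<Union>F) \<and> (\<forall>e\<in>F. card e = k)"

definition complete_ugraph :: "nat \<Rightarrow> nat \<Rightarrow> nat set set" where
  "complete_ugraph r n = {e. e \<subseteq> {1..n} \<and> card e = r}"

definition copy_of :: "'a set set \<Rightarrow> 'b set set \<Rightarrow> bool" where
  "copy_of F H \<longleftrightarrow> (\<exists>f. inj_on f (\<Union>F) \<and> H = (\<lambda>e. f ` e) ` F)"

definition free_of :: "'a set set set \<Rightarrow> 'b set set \<Rightarrow> bool" where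
  "free_of \<F> G \<longleftrightarrow> (\<forall>F\<in>\<F>. \<not> (\<exists>H\<subseteq>G. copy_of F H))"

text \<open>
  \<open>ex_num r n \<F>\<close> is a maximum over a finite set of naturals. That set is empty only if \<open>\<F>\<close>
  contains the edgeless graph, and then the supremum is 0.
\<close>

definition ex_num :: "nat \<Rightarrow> nat \<Rightarrow> 'a set set set \<Rightarrow> nat" where
  "ex_num r n \<F> = Sup {card G | G. G \<subseteq> complete_ugraph r n \<and> free_of \<F> G}"

definition rainbow :: "('a set \<Rightarrow> nat) \<Rightarrow> 'a set set \<Rightarrow> bool" where
  "rainbow \<chi> H \<longleftrightarrow> inj_on \<chi> H"

definition rainbow_free :: "nat \<Rightarrow> nat \<Rightarrow> (nat set \<Rightarrow> nat) \<Rightarrow> 'a set set set \<Rightarrow> bool" where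
  "rainbow_free r n \<chi> \<F> \<longleftrightarrow> (\<forall>H\<subseteq>complete_ugraph r n. rainbow \<chi> H \<longrightarrow> free_of \<F> H)"

text \<open>
  The number of colours ranges over positive integers: for \<open>m = 0\<close> there is no surjection from
  a nonempty set, and the condition would hold vacuously.
\<close>

definition ar :: "nat \<Rightarrow> nat \<Rightarrow> 'a set set \<Rightarrow> nat" where
  "ar r n F = (LEAST m. 1 \<le> m \<and>
     (\<forall>\<chi>. \<chi> ` complete_ugraph r n = {1..m} \<longrightarrow>
        (\<exists>H\<subseteq>complete_ugraph r n. rainbow \<chi> H \<and> copy_of F H)))"

text \<open>
  Expansion of a \<open>k\<close>-graph to uniformity \<open>r\<close>: old vertices are tagged \<open>Inl\<close>, and the new
  vertices of the edge \<open>e\<close> are \<open>Inr (e, i)\<close> for \<open>i < r - k\<close>.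
\<close>

definition expansion :: "nat \<Rightarrow> nat \<Rightarrow> 'a set set \<Rightarrow> ('a + 'a set \<times> nat) set set" where
  "expansion r k F = (\<lambda>e. Inl ` e \<union> Inr ` ({e} \<times> {..<r - k})) ` F"

definition remove_one_edge :: "'a set set \<Rightarrow> 'a set set set" where
  "remove_one_edge F = {F - {e} | e. e \<in> F}"

definition link :: "nat \<Rightarrow> 'a set set \<Rightarrow> 'a \<Rightarrow> 'a set set" where
  "link k F u = {e. e \<subseteq> \<Union>F \<and> card e = k - 1 \<and> e \<union> {u} \<in> F}"

text \<open>
  Since the type of vertices is infinite, a finite graph always has enough unused vertices
  \<open>v e\<close>; which ones are chosen affects the result only up to isomorphism.
\<close>

definition split_vertex :: "nat \<Rightarrow> 'a::infinite set set \<Rightarrow> 'a \<Rightarrow> 'a set set" where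
  "split_vertex k F u =
     (let v = (SOME v. inj_on v (link k F u) \<and> v ` link k F u \<inter> \<Union>F = {})
      in {e \<union> {v e} | e. e \<in> link k F u} \<union> {e \<in> F. u \<notin> e})"

text \<open>
  Independence is meant in the strong sense: no edge contains two vertices of \<open>I\<close>. For graphs
  (\<open>k = 2\<close>) this is the usual notion. For \<open>k > 2\<close> the weaker condition that \<open>I\<close> contains no
  edge would not do: an edge may then lose several vertices to splitting, whereas its expansion
  is only guaranteed one new vertex (\<open>r - k \<ge> 1\<close>).
\<close>

definition independent :: "'a set set \<Rightarrow> 'a set \<Rightarrow> bool" where
  "independent F I \<longleftrightarrow> I \<subseteq> \<Union>F \<and> (\<forall>e\<in>F. card (e \<inter> I) \<le> 1)"

definition Split :: "nat \<Rightarrow> 'a::infinite set set \<Rightarrow> 'a set set set" where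
  "Split k F = {foldl (split_vertex k) F us | us. distinct us \<and> independent F (set us)}"

end

theory Submission
  imports Defs
begin

text \<open>
  Take a maximal family of pairwise edge-disjoint copies, in the rainbow graph \<open>H\<close>, of expansions of
  members of \<open>F\<^sub>-\<close>, and delete all their edges. Each such copy \<open>C\<close> lacks one edge of \<open>F\<close>, whose
  vertices span a \<open>k\<close>-set, the core of \<open>C\<close>. An \<open>r\<close>-set that contains the core and otherwise avoids \<open>C\<close>
  completes \<open>C\<close> to a copy of the expansion of \<open>F\<close>, so its colour must occur on \<open>C\<close>; as \<open>H\<close> is rainbow,
  different copies carry different colours. Therefore distinct copies have distinct cores, and if the
  cores contained a member of \<open>Split(F)\<close>, then enlarging them by fresh vertices would give a rainbow
  expansion of \<open>F\<close>. Hence there are at most \<open>ex(n, Split(F))\<close> copies, with at most \<open>|F| - 1\<close> edges each.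
\<close>

section \<open>Fresh vertices and elementary bounds\<close>

lemma exists_fresh_injection:
  assumes "finite T" "finite V" "card T + card V \<le> n"
  obtains \<rho> :: "'b \<Rightarrow> nat" where "inj_on \<rho> T" "\<rho> ` T \<subseteq> {1..n} - V"
proof -
  have "card {1..n} - card V \<le> card ({1..n} - V)"
    by (rule diff_card_le_card_Diff) (use assms in simp)
  then have "card T \<le> card ({1..n} - V)"
    using assms(3) by simp
  then show ?thesis
    using inj_on_iff_card_le[of T "{1..n} - V"] assms(1) that by auto
qed

text \<open>Used to enlarge a core \<open>A\<close> to an edge that meets a given vertex set
  \<open>V\<close> in nothing but the core.\<close>

lemma exists_fresh_superset:
  assumes "finite V" "A \<subseteq> V" "A \<subseteq> {1..n}" "card A \<le> r" "r + card V \<le> n"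
  obtains B :: "nat set" where "A \<subseteq> B" "B \<subseteq> {1..n}" "card B = r" "B \<inter> V = A"
proof -
  have "card {..<r - card A} + card V \<le> n"
    using assms(5) by simp
  with exists_fresh_injection[of "{..<r - card A}" V n] assms(1)
  obtain \<rho> where \<rho>: "inj_on \<rho> {..<r - card A}" "\<rho> ` {..<r - card A} \<subseteq> {1..n} - V"
    by auto
  show ?thesis
  proof (rule that[of "A \<union> \<rho> ` {..<r - card A}"])
    have "finite A"
      using assms(1,2) finite_subset by blast
    moreover have "A \<inter> \<rho> ` {..<r - card A} = {}"
      using \<rho>(2) assms(2) by blast
    ultimately show "card (A \<union> \<rho> ` {..<r - card A}) = r"
      using assms(4) by (simp add: card_Un_disjoint card_image[OF \<rho>(1)])
  qed (use \<rho>(2) assms(2,3) in blast)+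
qed

lemma ugraph_finite:
  assumes "ugraph k F"
  shows "finite F" "e \<in> F \<Longrightarrow> finite e"
  using assms finite_UnionD finite_subset[of e "\<Union>F"] unfolding ugraph_def by blast+

lemma finite_complete_ugraph: "finite (complete_ugraph r n)"
  by (rule finite_subset[of _ "Pow {1..n}"]) (auto simp: complete_ugraph_def)

lemma card_Union_le:
  assumes "C \<subseteq> complete_ugraph r n"
  shows "card (\<Union>C) \<le> card C * r"
proof -
  have "card (\<Union>C) \<le> (\<Sum>e\<in>C. card e)"
    by (rule card_Union_le_sum_card)
  also have "\<dots> = (\<Sum>e\<in>C. r)"
    by (rule sum.cong) (use assms in \<open>auto simp: complete_ugraph_def\<close>)
  finally show ?thesis by simp
qed

lemma card_le_ex_num:
  assumes "G \<subseteq> complete_ugraph r n" "free_of \<F> G"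
  shows "card G \<le> ex_num r n \<F>"
  unfolding ex_num_def
proof (rule cSup_upper)
  show "bdd_above {card G |G. G \<subseteq> complete_ugraph r n \<and> free_of \<F> G}"
    by (rule bdd_aboveI[of _ "card (complete_ugraph r n)"])
       (auto intro: card_mono finite_complete_ugraph)
qed (use assms in blast)

section \<open>Embeddings of expansions\<close>

text \<open>An unordered description of a copy of an expansion: \<open>g\<close> places the old
  vertices and \<open>P e\<close> is the set of new vertices of \<open>e\<close>, with
  \<open>m = r - k\<close> in use. The numbering of new vertices in \<open>expansion\<close> is
  thereby forgotten.\<close>

definition expansion_embedding ::
    "nat \<Rightarrow> ('a \<Rightarrow> 'b) \<Rightarrow> ('a set \<Rightarrow> 'b set) \<Rightarrow> 'a set set \<Rightarrow> bool" where
  "expansion_embedding m g P F \<longleftrightarrow> inj_on g (\<Union>F) \<and>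
     (\<forall>e\<in>F. finite (P e) \<and> card (P e) = m \<and> P e \<inter> g ` \<Union>F = {}) \<and>
     (\<forall>e\<in>F. \<forall>e'\<in>F. e \<noteq> e' \<longrightarrow> P e \<inter> P e' = {})"

lemma expansion_embeddingD:
  assumes "expansion_embedding m g P F"
  shows "inj_on g (\<Union>F)"
    and "e \<in> F \<Longrightarrow> finite (P e)"
    and "e \<in> F \<Longrightarrow> card (P e) = m"
    and "e \<in> F \<Longrightarrow> P e \<inter> g ` \<Union>F = {}"
    and "e \<in> F \<Longrightarrow> e' \<in> F \<Longrightarrow> e \<noteq> e' \<Longrightarrow> P e \<inter> P e' = {}"
  using assms by (simp_all add: expansion_embedding_def)

lemma Union_expansion: "\<Union>(expansion r k F) = Inl ` \<Union>F \<union> Inr ` (F \<times> {..<r - k})"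
  unfolding expansion_def by auto

text \<open>Arbitrary bijections from \<open>{..<r - k}\<close> onto the sets \<open>P e\<close>
  combine with \<open>g\<close> into one map on the tagged vertices; the disjointness conditions
  make this map injective.\<close>

lemma expansion_embedding_imp_copy_of:
  assumes "expansion_embedding (r - k) g P F"
  shows "copy_of (expansion r k F) ((\<lambda>e. g ` e \<union> P e) ` F)"
proof -
  note D = expansion_embeddingD[OF assms]
  have "\<exists>h. bij_betw h {..<r - k} (P e)" if "e \<in> F" for e
    using ex_bij_betw_nat_finite[OF D(2)[OF that]] D(3)[OF that]
    by (simp add: atLeast0LessThan)
  then obtain h where h: "\<And>e. e \<in> F \<Longrightarrow> bij_betw (h e) {..<r - k} (P e)"
    by metis
  define f where "f = case_sum g (\<lambda>(e, i). h e i)"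
  have mem: "h e i \<in> P e" if "e \<in> F" "i < r - k" for e i
    using h[OF that(1)] that(2) by (auto simp: bij_betw_def)
  have "inj_on f (\<Union>(expansion r k F))"
    unfolding Union_expansion
  proof (rule inj_onI)
    fix x y
    assume x: "x \<in> Inl ` \<Union>F \<union> Inr ` (F \<times> {..<r - k})"
      and y: "y \<in> Inl ` \<Union>F \<union> Inr ` (F \<times> {..<r - k})" and eq: "f x = f y"
    have old_new: "g a = h e i \<Longrightarrow> False" if "a \<in> \<Union>F" "e \<in> F" "i < r - k" for a e i
      using mem[OF that(2,3)] D(4)[OF that(2)] imageI[OF that(1), of g]
      by (metis disjoint_iff)
    have new_new: "e = e' \<and> i = j"
      if "e \<in> F" "i < r - k" "e' \<in> F" "j < r - k" "h e i = h e' j" for e i e' j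
    proof -
      have "e = e'"
        using mem[OF that(1,2)] mem[OF that(3,4)] that(5) D(5)[OF that(1,3)] by auto
      with h[OF that(1)] that show ?thesis
        by (auto simp: bij_betw_def inj_on_def)
    qed
    have old_old: "a = b" if "a \<in> \<Union>F" "b \<in> \<Union>F" "g a = g b" for a b
      using inj_onD[OF D(1)] that by blast
    show "x = y"
    proof (cases x; cases y)
      fix a b assume "x = Inl a" "y = Inl b"
      with x y eq show ?thesis
        using old_old[of a b] by (auto simp: f_def)
    next
      fix a p assume "x = Inl a" "y = Inr p"
      with x y eq have "a \<in> \<Union>F" "fst p \<in> F" "snd p < r - k" "g a = h (fst p) (snd p)"
        by (auto simp: f_def split_beta)
      then show ?thesis
        using old_new by blast
    next
      fix a p assume "x = Inr p" "y = Inl a"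
      with x y eq have "a \<in> \<Union>F" "fst p \<in> F" "snd p < r - k" "g a = h (fst p) (snd p)"
        by (auto simp: f_def split_beta)
      then show ?thesis
        using old_new by blast
    next
      fix p q assume "x = Inr p" "y = Inr q"
      with x y eq show ?thesis
        using new_new[of "fst p" "snd p" "fst q" "snd q"] by (auto simp: f_def)
    qed
  qed
  moreover have "f ` (Inl ` e \<union> Inr ` ({e} \<times> {..<r - k})) = g ` e \<union> P e" if "e \<in> F" for e
  proof -
    have "f ` Inr ` ({e} \<times> {..<r - k}) = h e ` {..<r - k}"
      unfolding f_def by force
    moreover have "f ` Inl ` e = g ` e"
      unfolding f_def by force
    ultimately show ?thesis
      using h[OF that] by (simp add: image_Un bij_betw_def)
  qed
  then have "(\<lambda>e. g ` e \<union> P e) ` F = (\<lambda>e. f ` e) ` expansion r k F"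
    unfolding expansion_def image_image by (intro image_cong) auto
  ultimately show ?thesis
    unfolding copy_of_def by blast
qed

text \<open>The copying map restricted to the \<open>Inl\<close> vertices serves as
  \<open>g\<close>, and the image of the \<open>Inr\<close> vertices belonging to \<open>e\<close>
  serves as \<open>P e\<close>.\<close>

lemma copy_of_imp_expansion_embedding:
  assumes "copy_of (expansion r k F) H"
  obtains g P where "expansion_embedding (r - k) g P F" "H = (\<lambda>e. g ` e \<union> P e) ` F"
proof -
  obtain f where f: "inj_on f (\<Union>(expansion r k F))" "H = (\<lambda>e. f ` e) ` expansion r k F"
    using assms unfolding copy_of_def by blast
  define P where "P e = f ` Inr ` ({e} \<times> {..<r - k})" for e
  note inj = f(1)[unfolded Union_expansion]
  have card: "finite (P e) \<and> card (P e) = r - k" if "e \<in> F" for e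
  proof -
    have "inj_on f (Inr ` ({e} \<times> {..<r - k}))"
      by (rule inj_on_subset[OF inj]) (use that in auto)
    then show ?thesis
      unfolding P_def by (simp add: card_image)
  qed
  have disj: "P e \<inter> P e' = {}" if "e \<in> F" "e' \<in> F" "e \<noteq> e'" for e e'
  proof -
    have "P e \<inter> P e' = f ` (Inr ` ({e} \<times> {..<r - k}) \<inter> Inr ` ({e'} \<times> {..<r - k}))"
      unfolding P_def by (rule inj_on_image_Int[OF inj, symmetric]) (use that in auto)
    also have "Inr ` ({e} \<times> {..<r - k}) \<inter> Inr ` ({e'} \<times> {..<r - k}) = {}"
      using that by auto
    finally show ?thesis by simp
  qed
  have core: "P e \<inter> (f \<circ> Inl) ` \<Union>F = {}" if "e \<in> F" for e
  proof -
    have "P e \<inter> f ` Inl ` \<Union>F = f ` (Inr ` ({e} \<times> {..<r - k}) \<inter> Inl ` \<Union>F)"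
      unfolding P_def by (rule inj_on_image_Int[OF inj, symmetric]) (use that in auto)
    also have "Inr ` ({e} \<times> {..<r - k}) \<inter> Inl ` \<Union>F = {}"
      by auto
    finally show ?thesis by (simp add: image_comp)
  qed
  have "inj_on (f \<circ> Inl) (\<Union>F)"
    by (rule comp_inj_on) (auto intro: inj_on_subset[OF inj])
  with card core disj have "expansion_embedding (r - k) (f \<circ> Inl) P F"
    unfolding expansion_embedding_def by auto
  moreover have "H = (\<lambda>e. (f \<circ> Inl) ` e \<union> P e) ` F"
    unfolding f(2) expansion_def P_def image_image by (simp add: image_Un image_comp)
  ultimately show ?thesis
    by (rule that)
qed

lemma expansion_embedding_card_edge:
  assumes "expansion_embedding m g P F" "ugraph k F" "e \<in> F"
  shows "card (g ` e \<union> P e) = k + m"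
proof -
  note D = expansion_embeddingD[OF assms(1)]
  have fin: "finite e" "finite (P e)"
    using ugraph_finite(2)[OF assms(2,3)] D(2)[OF assms(3)] .
  have "inj_on g e"
    by (rule inj_on_subset[OF D(1)]) (use assms(3) in blast)
  moreover have "card e = k"
    using assms(2,3) unfolding ugraph_def by blast
  moreover have "g ` e \<subseteq> g ` \<Union>F"
    using assms(3) by blast
  then have "g ` e \<inter> P e = {}"
    using D(4)[OF assms(3)] by (metis Int_commute disjoint_eq_subset_Compl order_trans)
  ultimately show "card (g ` e \<union> P e) = k + m"
    using fin D(3)[OF assms(3)] by (simp add: card_Un_disjoint card_image)
qed

text \<open>
  The vertices of \<open>e\<^sub>0\<close> outside the other edges of \<open>F\<close> do not occur in \<open>C\<close>, so their images have
  to be chosen; this is where room in \<open>{1..n}\<close> is needed.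
\<close>

lemma missing_edge_core:
  fixes C :: "nat set set"
  assumes F: "ugraph k F" and e0: "e\<^sub>0 \<in> F"
    and C: "copy_of (expansion r k (F - {e\<^sub>0})) C" "C \<subseteq> complete_ugraph r n"
    and n: "k + card (\<Union>C) \<le> n"
  obtains A where "A \<in> complete_ugraph k n"
    "\<And>B. B \<in> complete_ugraph r n \<Longrightarrow> A \<subseteq> B \<Longrightarrow> B \<inter> \<Union>C \<subseteq> A \<Longrightarrow>
       copy_of (expansion r k F) (insert B C)"
proof -
  obtain g P where gP: "expansion_embedding (r - k) g P (F - {e\<^sub>0})"
      "C = (\<lambda>e. g ` e \<union> P e) ` (F - {e\<^sub>0})"
    using copy_of_imp_expansion_embedding[OF C(1)] by blast
  let ?W = "\<Union>(F - {e\<^sub>0})"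
  have VC: "\<Union>C \<subseteq> {1..n}"
    using C(2) unfolding complete_ugraph_def by blast
  have gW: "g ` ?W \<subseteq> \<Union>C" and PC: "\<And>e. e \<in> F - {e\<^sub>0} \<Longrightarrow> P e \<subseteq> \<Union>C"
    unfolding gP(2) by auto
  have fin0: "finite e\<^sub>0" and card0: "card e\<^sub>0 = k"
    using F e0 ugraph_finite unfolding ugraph_def by blast+
  have "finite (\<Union>C)"
    using VC finite_subset by blast
  moreover have "card (e\<^sub>0 - ?W) + card (\<Union>C) \<le> n"
    using n card_mono[OF fin0, of "e\<^sub>0 - ?W"] card0 by auto
  ultimately obtain \<rho> where \<rho>: "inj_on \<rho> (e\<^sub>0 - ?W)" "\<rho> ` (e\<^sub>0 - ?W) \<subseteq> {1..n} - \<Union>C"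
    using exists_fresh_injection[of "e\<^sub>0 - ?W" "\<Union>C" n] fin0 by blast
  define g' where "g' x = (if x \<in> ?W then g x else \<rho> x)" for x
  have UF: "\<Union>F = ?W \<union> (e\<^sub>0 - ?W)"
    using e0 by blast
  have g'W: "g' ` X = g ` X" if "X \<subseteq> ?W" for X
    unfolding g'_def using that by (intro image_cong) auto
  have g'0: "g' ` (e\<^sub>0 - ?W) = \<rho> ` (e\<^sub>0 - ?W)"
    unfolding g'_def by (intro image_cong) auto
  have inj: "inj_on g' (\<Union>F)"
    unfolding UF
  proof (subst inj_on_Un, intro conjI)
    have "inj_on g ?W"
      using gP(1) unfolding expansion_embedding_def by blast
    then show "inj_on g' ?W"
      using inj_on_cong[of ?W g' g] unfolding g'_def by simp
    show "inj_on g' (e\<^sub>0 - ?W)"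
      using \<rho>(1) inj_on_cong[of "e\<^sub>0 - ?W" g' \<rho>] unfolding g'_def by simp
    have "g' ` ?W \<inter> g' ` (e\<^sub>0 - ?W) = {}"
      unfolding g'W[OF order_refl] g'0 using gW \<rho>(2) by blast
    then show "g' ` (?W - (e\<^sub>0 - ?W)) \<inter> g' ` (e\<^sub>0 - ?W - ?W) = {}"
      by blast
  qed
  have img: "g' ` \<Union>F = g ` ?W \<union> \<rho> ` (e\<^sub>0 - ?W)"
    unfolding UF image_Un using g'W[of ?W] g'0 by simp
  have "inj_on g' e\<^sub>0"
    by (rule inj_on_subset[OF inj]) (use e0 in blast)
  then have card0': "card (g' ` e\<^sub>0) = k"
    using card0 card_image by metis
  show ?thesis
  proof (rule that[of "g' ` e\<^sub>0"])
    have "g' ` \<Union>F \<subseteq> {1..n}"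
      unfolding img using gW VC \<rho>(2) by (meson Diff_subset Un_least order_trans)
    then have "g' ` e\<^sub>0 \<subseteq> {1..n}"
      by (rule order_trans[rotated]) (use e0 in blast)
    with card0' show "g' ` e\<^sub>0 \<in> complete_ugraph k n"
      unfolding complete_ugraph_def by simp
  next
    fix B assume B: "B \<in> complete_ugraph r n" "g' ` e\<^sub>0 \<subseteq> B" "B \<inter> \<Union>C \<subseteq> g' ` e\<^sub>0"
    \<comment> \<open>The part of \<open>B\<close> outside the core supplies the expansion vertices
      of the missing edge.\<close>
    define P' where "P' = P(e\<^sub>0 := B - g' ` e\<^sub>0)"
    have B': "finite B" "card B = r"
      using B(1) finite_subset[of B "{1..n}"] unfolding complete_ugraph_def by auto
    have "card (B - g' ` e\<^sub>0) = r - k"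
      using card_Diff_subset[of "g' ` e\<^sub>0" B] fin0 B(2) B'(2) card0'
      by simp
    moreover have new: "(B - g' ` e\<^sub>0) \<inter> \<Union>C = {}"
      using B(3) by blast
    moreover have "g' ` \<Union>F \<subseteq> \<Union>C \<union> g' ` e\<^sub>0"
      unfolding img g'0[symmetric] using gW by blast
    then have "(B - g' ` e\<^sub>0) \<inter> g' ` \<Union>F = {}"
      using new by blast
    moreover have "P e \<inter> g' ` \<Union>F = {}" if "e \<in> F - {e\<^sub>0}" for e
      unfolding img using PC[OF that] \<rho>(2) expansion_embeddingD(4)[OF gP(1) that]
      by blast
    moreover have "(B - g' ` e\<^sub>0) \<inter> P e = {}" if "e \<in> F - {e\<^sub>0}" for e
      using PC[OF that] new by blast
    ultimately have "expansion_embedding (r - k) g' P' F"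
      using inj B'(1) expansion_embeddingD[OF gP(1)]
      unfolding expansion_embedding_def P'_def by (auto simp: Int_commute)
    then have "copy_of (expansion r k F) ((\<lambda>e. g' ` e \<union> P' e) ` F)"
      by (rule expansion_embedding_imp_copy_of)
    also have "(\<lambda>e. g' ` e \<union> P' e) ` F = insert B C"
    proof -
      have "F = insert e\<^sub>0 (F - {e\<^sub>0})"
        using e0 by blast
      then have "(\<lambda>e. g' ` e \<union> P' e) ` F =
          insert (g' ` e\<^sub>0 \<union> P' e\<^sub>0) ((\<lambda>e. g' ` e \<union> P' e) ` (F - {e\<^sub>0}))"
        by (metis image_insert)
      moreover have "g' ` e\<^sub>0 \<union> P' e\<^sub>0 = B"
        using B(2) unfolding P'_def by auto
      moreover have "(\<lambda>e. g' ` e \<union> P' e) ` (F - {e\<^sub>0}) = C"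
        unfolding gP(2) by (intro image_cong refl) (simp add: P'_def g'W Union_upper)
      ultimately show ?thesis by simp
    qed
    finally show "copy_of (expansion r k F) (insert B C)" .
  qed
qed

section \<open>Iterated splitting\<close>

text \<open>
  A new vertex may coincide with a vertex split earlier, since that one has disappeared from the
  graph; hence \<open>w e\<close> is only required to avoid the unsplit vertices.
\<close>

definition split_witness :: "'a set set \<Rightarrow> 'a set \<Rightarrow> ('a set \<Rightarrow> 'a) \<Rightarrow> bool" where
  "split_witness F I w \<longleftrightarrow> inj_on w {e \<in> F. e \<inter> I \<noteq> {}} \<and>
     (\<forall>e\<in>F. e \<inter> I \<noteq> {} \<longrightarrow> w e \<notin> \<Union>F - I)"

text \<open>Closed form of successive splitting: an edge meets an independent \<open>I\<close> in at
  most one vertex, so at most that vertex is replaced, by a vertex \<open>w e\<close> private to the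
  edge.\<close>

definition split_edge :: "'a set \<Rightarrow> ('a set \<Rightarrow> 'a) \<Rightarrow> 'a set \<Rightarrow> 'a set" where
  "split_edge I w e = (if e \<inter> I = {} then e else insert (w e) (e - I))"

text \<open>Inductive step. No edge through \<open>u\<close> has been changed by the earlier
  splittings, so the link of \<open>u\<close> is still its link in \<open>F\<close>, and the fresh
  vertices chosen for this link turn \<open>w\<close> into \<open>w'\<close>.\<close>

lemma split_vertex_split_edges:
  fixes F :: "'a::infinite set set"
  assumes k: "1 \<le> k" and F: "ugraph k F" and w: "split_witness F I w"
    and u: "u \<in> \<Union>F" "u \<notin> I" and ind: "\<And>e. e \<in> F \<Longrightarrow> u \<in> e \<Longrightarrow> e \<inter> I = {}"
  obtains w' where "split_witness F (insert u I) w'"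
    "split_vertex k (split_edge I w ` F) u = split_edge (insert u I) w' ` F"
proof -
  let ?G = "split_edge I w ` F"
  have mem: "u \<in> split_edge I w e \<longleftrightarrow> u \<in> e" if "e \<in> F" for e
    using that u w unfolding split_edge_def split_witness_def by auto
  have same: "split_edge I w e = e" if "e \<in> F" "u \<in> e" for e
    using ind[OF that] unfolding split_edge_def by simp
  \<comment> \<open>Unsplit vertices survive, so a vertex fresh for the current graph also avoids
    every unsplit vertex of \<open>F\<close>.\<close>
  have cov: "\<Union>F - I \<subseteq> \<Union>?G"
    unfolding split_edge_def by (auto 4 4)
  have link: "link k ?G u = (\<lambda>e. e - {u}) ` {e \<in> F. u \<in> e}"
  proof (intro equalityI subsetI)
    fix d assume "d \<in> link k ?G u"
    then have d: "card d = k - 1" "d \<union> {u} \<in> ?G"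
      unfolding link_def by auto
    then obtain e where e: "e \<in> F" "d \<union> {u} = split_edge I w e"
      by auto
    then have eq: "d \<union> {u} = e" "u \<in> e"
      using mem same by auto
    have "card e = k" "finite e"
      using e(1) F ugraph_finite unfolding ugraph_def by blast+
    \<comment> \<open>Otherwise \<open>d = e\<close> would have \<open>k\<close> elements rather
      than \<open>k - 1\<close>; here \<open>1 \<le> k\<close> matters.\<close>
    then have "u \<notin> d"
      using d(1) eq(1) k by (auto simp: insert_absorb)
    then show "d \<in> (\<lambda>e. e - {u}) ` {e \<in> F. u \<in> e}"
      using e(1) eq by auto
  next
    fix d assume "d \<in> (\<lambda>e. e - {u}) ` {e \<in> F. u \<in> e}"
    then obtain e where e: "e \<in> F" "u \<in> e" "d = e - {u}"
      by auto
    have "card e = k" "finite e"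
      using e(1) F ugraph_finite unfolding ugraph_def by blast+
    moreover have "e \<in> ?G"
      using e same by (metis image_eqI)
    ultimately show "d \<in> link k ?G u"
      using e unfolding link_def by (auto simp: insert_absorb)
  qed
  have fin: "finite (link k ?G u)" "finite (\<Union>?G)"
    using link ugraph_finite[OF F] unfolding split_edge_def by auto
  \<comment> \<open>Existence is what gives the \<open>SOME\<close> in \<open>split_vertex\<close>
    its intended value; it uses that the vertex type is infinite.\<close>
  have ex: "\<exists>v. inj_on v (link k ?G u) \<and> v ` link k ?G u \<inter> \<Union>?G = {}"
  proof -
    have "infinite (- \<Union>?G)"
      using fin(2) by (simp add: Compl_eq_Diff_UNIV infinite_UNIV)
    then obtain X where X: "finite X" "card X = card (link k ?G u)" "X \<subseteq> - \<Union>?G"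
      using infinite_arbitrarily_large by metis
    then obtain v where "bij_betw v (link k ?G u) X"
      using finite_same_card_bij[OF fin(1)] by metis
    with X(3) show ?thesis
      by (intro exI[of _ v]) (auto simp: bij_betw_def)
  qed
  define v where "v = (SOME v. inj_on v (link k ?G u) \<and> v ` link k ?G u \<inter> \<Union>?G = {})"
  have v: "inj_on v (link k ?G u)" "v ` link k ?G u \<inter> \<Union>?G = {}"
    using someI_ex[OF ex] unfolding v_def by blast+
  have sp: "split_vertex k ?G u = {e \<union> {v e} | e. e \<in> link k ?G u} \<union> {e \<in> ?G. u \<notin> e}"
    unfolding split_vertex_def Let_def v_def by (rule refl)
  define w' where "w' e = (if u \<in> e then v (e - {u}) else w e)" for e
  have fresh: "w' e \<notin> \<Union>?G" if "e \<in> F" "u \<in> e" for e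
    using v(2) that unfolding w'_def link by auto
  \<comment> \<open>Earlier replacement vertices belong to the current graph, so the new choice
    \<open>v\<close> avoids them. This settles the mixed cases of injectivity below.\<close>
  have old: "w e \<in> \<Union>?G" if "e \<in> F" "e \<inter> I \<noteq> {}" for e
    using that unfolding split_edge_def by auto
  have "inj_on w' {e \<in> F. e \<inter> insert u I \<noteq> {}}"
  proof (rule inj_onI)
    fix a b assume a: "a \<in> {e \<in> F. e \<inter> insert u I \<noteq> {}}"
      and b: "b \<in> {e \<in> F. e \<inter> insert u I \<noteq> {}}" and eq: "w' a = w' b"
    consider "u \<in> a" "u \<in> b" | "u \<in> a" "u \<notin> b" | "u \<notin> a" "u \<in> b" | "u \<notin> a" "u \<notin> b"
      by blast
    then show "a = b"
    proof cases
      case 1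
      with a b eq have "a - {u} = b - {u}"
        by (intro inj_onD[OF v(1)]) (auto simp: w'_def link)
      with 1 show ?thesis by blast
    next
      case 2
      then have "w' b \<in> \<Union>?G"
        using b old[of b] unfolding w'_def by auto
      then show ?thesis
        using fresh[of a] 2 a eq by simp
    next
      case 3
      then have "w' a \<in> \<Union>?G"
        using a old[of a] unfolding w'_def by auto
      then show ?thesis
        using fresh[of b] 3 b eq by simp
    next
      case 4
      with a b eq have "a \<in> {e \<in> F. e \<inter> I \<noteq> {}}" "b \<in> {e \<in> F. e \<inter> I \<noteq> {}}" "w a = w b"
        unfolding w'_def by auto
      with w show ?thesis
        unfolding split_witness_def by (meson inj_onD)
    qed
  qed
  moreover have "w' e \<notin> \<Union>F - insert u I" if "e \<in> F" "e \<inter> insert u I \<noteq> {}" for e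
  proof (cases "u \<in> e")
    case True
    with fresh[OF that(1)] cov show ?thesis by blast
  next
    case False
    with that w show ?thesis
      unfolding split_witness_def w'_def by auto
  qed
  ultimately have W: "split_witness F (insert u I) w'"
    unfolding split_witness_def by blast
  have hit: "split_edge (insert u I) w' e = (e - {u}) \<union> {v (e - {u})}" if "e \<in> F" "u \<in> e" for e
    using that ind[OF that] unfolding split_edge_def w'_def by auto
  have miss: "split_edge (insert u I) w' e = split_edge I w e" if "e \<in> F" "u \<notin> e" for e
    using that unfolding split_edge_def w'_def by auto
  have "{e \<union> {v e} | e. e \<in> link k ?G u} = split_edge (insert u I) w' ` {e \<in> F. u \<in> e}"
    unfolding link using hit by (auto simp: image_iff)
  moreover have "{e \<in> ?G. u \<notin> e} = split_edge (insert u I) w' ` {e \<in> F. u \<notin> e}"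
    using mem miss by (auto simp: image_iff)
  ultimately have "split_vertex k ?G u = split_edge (insert u I) w' ` F"
    unfolding sp by auto
  with W show ?thesis by (rule that)
qed

text \<open>Induction from the right, since \<open>foldl\<close> splits the last vertex last. By
  independence an edge through that vertex contains no vertex split before.\<close>

lemma foldl_split_vertex:
  fixes F :: "'a::infinite set set"
  assumes "1 \<le> k" "ugraph k F" "distinct us" "independent F (set us)"
  shows "\<exists>w. split_witness F (set us) w \<and>
    foldl (split_vertex k) F us = split_edge (set us) w ` F"
  using assms(3,4)
proof (induction us rule: rev_induct)
  case Nil
  show ?case
    by (auto simp: split_witness_def split_edge_def)
next
  case (snoc u us)
  have le1: "card (e \<inter> insert u (set us)) \<le> 1" if "e \<in> F" for e
    using snoc.prems(2) that unfolding independent_def by simp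
  have "card (e \<inter> set us) \<le> 1" if "e \<in> F" for e
    using le1[OF that] card_mono[of "e \<inter> insert u (set us)" "e \<inter> set us"] by fastforce
  with snoc.prems have "independent F (set us)" "distinct us"
    unfolding independent_def by auto
  with snoc.IH obtain w where w: "split_witness F (set us) w"
    "foldl (split_vertex k) F us = split_edge (set us) w ` F"
    by blast
  have ind: "e \<inter> set us = {}" if e: "e \<in> F" "u \<in> e" for e
  proof (rule ccontr)
    assume "e \<inter> set us \<noteq> {}"
    then obtain x where "x \<in> e" "x \<in> set us" "x \<noteq> u"
      using snoc.prems(1) by auto
    then have "card {x, u} \<le> card (e \<inter> insert u (set us))"
      using e by (intro card_mono) auto
    with le1[OF e(1)] \<open>x \<noteq> u\<close> show False by simp
  qed
  have "u \<in> \<Union>F" "u \<notin> set us"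
    using snoc.prems unfolding independent_def by auto
  from split_vertex_split_edges[OF assms(1,2) w(1) this ind] w(2) show ?case
    by simp metis
qed

text \<open>In a split edge \<open>w e\<close> is the only vertex outside
  \<open>\<Union>F - I\<close>, so it can be read off and determines \<open>e\<close>; an unsplit
  edge has no such vertex.\<close>

lemma inj_on_split_edge:
  assumes "split_witness F I w"
  shows "inj_on (split_edge I w) F"
proof (rule inj_onI)
  fix a b assume ab: "a \<in> F" "b \<in> F" "split_edge I w a = split_edge I w b"
  have new: "w e \<notin> \<Union>F - I" if "e \<in> F" "e \<inter> I \<noteq> {}" for e
    using that assms unfolding split_witness_def by blast
  consider "a \<inter> I = {}" "b \<inter> I = {}" | "a \<inter> I = {}" "b \<inter> I \<noteq> {}"
    | "a \<inter> I \<noteq> {}" "b \<inter> I = {}" | "a \<inter> I \<noteq> {}" "b \<inter> I \<noteq> {}"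
    by blast
  then show "a = b"
  proof cases
    case 4
    then have "w a = w b"
      using ab new[OF ab(1)] unfolding split_edge_def by auto
    with 4 ab assms show ?thesis
      unfolding split_witness_def inj_on_def by blast
  next
    case 2
    then have "w b \<in> a"
      using ab unfolding split_edge_def by auto
    with 2 ab new[of b] show ?thesis by blast
  next
    case 3
    then have "w a \<in> b"
      using ab unfolding split_edge_def by auto
    with 3 ab new[of a] show ?thesis by blast
  qed (use ab in \<open>simp add: split_edge_def\<close>)
qed

section \<open>Edge-disjoint copies in a rainbow graph\<close>

text \<open>A packing of edge-disjoint copies in which the missing edge and the embedding of each
  copy \<open>C\<close> are forgotten: only its core \<open>A C\<close> and the extension property
  of the core are kept. The bound on \<open>card C\<close> serves to limit the number of vertices of
  \<open>C\<close>.\<close>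

locale rainbow_packing =
  fixes r k n :: nat and F :: "'a::infinite set set" and \<chi> :: "nat set \<Rightarrow> nat"
    and H :: "nat set set" and \<C> :: "nat set set set" and A :: "nat set set \<Rightarrow> nat set"
  assumes k: "1 \<le> k" "k < r" and F: "ugraph k F"
    and rainbow_free: "rainbow_free r n \<chi> {expansion r k F}"
    and H: "H \<subseteq> complete_ugraph r n" "inj_on \<chi> H"
    and sub: "\<And>C. C \<in> \<C> \<Longrightarrow> C \<subseteq> H"
    and disj: "\<And>C D. C \<in> \<C> \<Longrightarrow> D \<in> \<C> \<Longrightarrow> C \<noteq> D \<Longrightarrow> C \<inter> D = {}"
    and card_C: "\<And>C. C \<in> \<C> \<Longrightarrow> card C \<le> card F"
    and core: "\<And>C. C \<in> \<C> \<Longrightarrow> A C \<in> complete_ugraph k n"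
    and extend: "\<And>C B. C \<in> \<C> \<Longrightarrow> B \<in> complete_ugraph r n \<Longrightarrow> A C \<subseteq> B \<Longrightarrow>
      B \<inter> \<Union>C \<subseteq> A C \<Longrightarrow> copy_of (expansion r k F) (insert B C)"
begin

lemma no_rainbow_copy:
  assumes "G \<subseteq> complete_ugraph r n" "inj_on \<chi> G"
  shows "\<not> copy_of (expansion r k F) G"
  using assms rainbow_free unfolding rainbow_free_def free_of_def rainbow_def by auto

text \<open>As a subgraph of \<open>H\<close>, the member \<open>C\<close> is rainbow; a colour of
  \<open>B\<close> new to \<open>C\<close> would make \<open>insert B C\<close> a rainbow copy of
  the expansion.\<close>

lemma colour_mem:
  assumes "C \<in> \<C>" "B \<in> complete_ugraph r n" "A C \<subseteq> B" "B \<inter> \<Union>C \<subseteq> A C"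
  shows "\<chi> B \<in> \<chi> ` C"
proof (rule ccontr)
  assume "\<chi> B \<notin> \<chi> ` C"
  moreover have "inj_on \<chi> C"
    using H(2) sub[OF assms(1)] inj_on_subset by blast
  ultimately have "inj_on \<chi> (insert B C)"
    by auto
  then show False
    using no_rainbow_copy[of "insert B C"] extend[OF assms] assms(2) sub[OF assms(1)] H(1) by blast
qed

lemma colours_disjoint:
  assumes "C \<in> \<C>" "D \<in> \<C>" "C \<noteq> D"
  shows "\<chi> ` C \<inter> \<chi> ` D = {}"
  using inj_on_image_Int[OF H(2) sub[OF assms(1)] sub[OF assms(2)]] disj[OF assms] by simp

lemma vertices_of_member:
  assumes "C \<in> \<C>"
  shows "finite (\<Union>C)" "card (\<Union>C) \<le> card F * r"
proof -
  have C: "C \<subseteq> complete_ugraph r n"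
    using sub[OF assms] H(1) by blast
  then have "\<Union>C \<subseteq> {1..n}"
    unfolding complete_ugraph_def by blast
  then show "finite (\<Union>C)"
    using finite_subset by blast
  show "card (\<Union>C) \<le> card F * r"
    using card_Union_le[OF C] mult_le_mono1[OF card_C[OF assms]] by (rule order_trans)
qed

text \<open>If two members shared a core, an edge meeting both only in that core would have a colour
  occurring on both. The term \<open>2 * (card F * r)\<close> bounds the vertices of the two
  members.\<close>

lemma core_inj:
  assumes n: "r + k + 2 * (card F * r) \<le> n"
  shows "inj_on A \<C>"
proof (rule inj_onI, rule ccontr)
  fix C D assume CD: "C \<in> \<C>" "D \<in> \<C>" "A C = A D" "C \<noteq> D"
  have A: "finite (A C)" "card (A C) = k" "A C \<subseteq> {1..n}"
    using core[OF CD(1)] finite_subset[of "A C" "{1..n}"] unfolding complete_ugraph_def by auto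
  let ?V = "A C \<union> (\<Union>C \<union> \<Union>D)"
  have "card ?V \<le> k + (card (\<Union>C) + card (\<Union>D))"
    using card_Un_le[of "A C" "\<Union>C \<union> \<Union>D"] card_Un_le[of "\<Union>C" "\<Union>D"] A(2) by linarith
  also have "\<dots> \<le> k + 2 * (card F * r)"
    using vertices_of_member(2)[OF CD(1)] vertices_of_member(2)[OF CD(2)] by simp
  finally have "r + card ?V \<le> n"
    using n by simp
  moreover have "finite ?V"
    using A(1) vertices_of_member(1) CD(1,2) by simp
  ultimately obtain B where B: "A C \<subseteq> B" "B \<subseteq> {1..n}" "card B = r" "B \<inter> ?V = A C"
    using exists_fresh_superset[of ?V "A C" n r] A k by auto
  then have "B \<in> complete_ugraph r n"
    unfolding complete_ugraph_def by simp
  moreover have "B \<inter> \<Union>C \<subseteq> A C" "B \<inter> \<Union>D \<subseteq> A C"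
    using B(4) by blast+
  ultimately have "\<chi> B \<in> \<chi> ` C \<inter> \<chi> ` D"
    using colour_mem[of C B] colour_mem[of D B] CD B(1) by simp
  then show False
    using colours_disjoint[OF CD(1,2,4)] by simp
qed

text \<open>
  Given a copy of \<open>F \<or> I\<close> among the cores, re-merge the split vertices: each vertex of \<open>I\<close> gets a fresh
  image, and the copy of \<open>w e\<close> becomes one of the \<open>r - k \<ge> 1\<close> expansion vertices of \<open>e\<close>.
\<close>

lemma cores_Split_free:
  assumes n: "card F * (card F * r) + card F * k + card (\<Union>F) + card F * r \<le> n"
  shows "free_of (Split k F) (A ` \<C>)"
  unfolding free_of_def
proof (intro ballI notI)
  fix F' assume "F' \<in> Split k F" and "\<exists>G\<subseteq>A ` \<C>. copy_of F' G"
  then obtain us G where us: "distinct us" "independent F (set us)"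
    and F': "F' = foldl (split_vertex k) F us" and G: "G \<subseteq> A ` \<C>" "copy_of F' G"
    unfolding Split_def by blast
  define I where "I = set us"
  obtain w where w: "split_witness F I w" and F'w: "F' = split_edge I w ` F"
    using foldl_split_vertex[OF k(1) F us] F' unfolding I_def by blast
  let ?\<phi> = "split_edge I w"
  obtain f where f: "inj_on f (\<Union>F')" "G = (\<lambda>e. f ` e) ` F'"
    using G(2) unfolding copy_of_def by blast
  have "\<exists>C\<in>\<C>. f ` ?\<phi> e = A C" if "e \<in> F" for e
  proof -
    have "f ` ?\<phi> e \<in> A ` \<C>"
      using G(1) that unfolding f(2) F'w by blast
    then show ?thesis by blast
  qed
  then obtain c where c: "\<And>e. e \<in> F \<Longrightarrow> c e \<in> \<C>" "\<And>e. e \<in> F \<Longrightarrow> f ` ?\<phi> e = A (c e)"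
    by metis
  have \<phi>F': "?\<phi> e \<subseteq> \<Union>F'" if "e \<in> F" for e
    using that unfolding F'w by blast
  \<comment> \<open>Distinct edges of \<open>F\<close> must use distinct members of the packing,
    because the colours of different members are disjoint.\<close>
  have c_neq: "c e \<noteq> c e'" if "e \<in> F" "e' \<in> F" "e \<noteq> e'" for e e'
  proof
    assume "c e = c e'"
    then have "f ` ?\<phi> e = f ` ?\<phi> e'"
      using c(2) that by simp
    then have "?\<phi> e = ?\<phi> e'"
      using inj_on_image_eq_iff[OF f(1) \<phi>F'[OF that(1)] \<phi>F'[OF that(2)]] by simp
    then show False
      using inj_onD[OF inj_on_split_edge[OF w] _ that(1,2)] that(3) by simp
  qed
  have finF: "finite F"
    using ugraph_finite(1)[OF F] .
  have new: "w e \<notin> \<Union>F - I" if "e \<in> F" "e \<inter> I \<noteq> {}" for e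
    using that w unfolding split_witness_def by blast
  have wF': "w e \<in> \<Union>F'" if "e \<in> F" "e \<inter> I \<noteq> {}" for e
    using \<phi>F'[OF that(1)] that(2) unfolding split_edge_def by auto
  have oldF': "e - I \<subseteq> \<Union>F'" if "e \<in> F" for e
    using \<phi>F'[OF that] unfolding split_edge_def by (auto split: if_splits)
  have core_c: "finite (A (c e))" "card (A (c e)) = k" "A (c e) \<subseteq> {1..n}" if "e \<in> F" for e
    using core[OF c(1)[OF that]] finite_subset[of "A (c e)" "{1..n}"]
    unfolding complete_ugraph_def by auto
  \<comment> \<open>Everything the fresh vertices have to avoid. The cores are listed separately
    because a core may have vertices outside its member.\<close>
  define V where "V = (\<Union>e\<in>F. \<Union>(c e)) \<union> (\<Union>e\<in>F. A (c e))"
  have finV: "finite V"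
    unfolding V_def using finF core_c(1) vertices_of_member(1) c(1) by blast
  have "card V \<le> card (\<Union>e\<in>F. \<Union>(c e)) + card (\<Union>e\<in>F. A (c e))"
    unfolding V_def by (rule card_Un_le)
  also have "card (\<Union>e\<in>F. \<Union>(c e)) \<le> (\<Sum>e\<in>F. card (\<Union>(c e)))"
    by (rule card_UN_le[OF finF])
  also have "\<dots> \<le> card F * (card F * r)"
    using sum_bounded_above[of F "\<lambda>e. card (\<Union>(c e))" "card F * r"] vertices_of_member(2) c(1) by simp
  also have "card (\<Union>e\<in>F. A (c e)) \<le> (\<Sum>e\<in>F. card (A (c e)))"
    by (rule card_UN_le[OF finF])
  also have "\<dots> = card F * k"
    using core_c(2) by simp
  finally have cardV: "card V \<le> card F * (card F * r) + card F * k"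
    by simp
  \<comment> \<open>One injection provides all fresh vertices: \<open>Inl x\<close> for a split
    vertex \<open>x\<close>, \<open>Inr (e, i)\<close> for an expansion vertex of \<open>e\<close>.
    The range \<open>i < r\<close> is larger than any edge uses and keeps the index set a
    product.\<close>
  let ?T = "Inl ` \<Union>F \<union> Inr ` (F \<times> {..<r}) :: ('a + 'a set \<times> nat) set"
  have "card ?T \<le> card (\<Union>F) + card F * r"
    using card_Un_le[of "Inl ` \<Union>F" "Inr ` (F \<times> {..<r})"]
    by (simp add: card_image card_cartesian_product)
  moreover have "finite ?T"
    using finF F unfolding ugraph_def by simp
  ultimately obtain \<rho> where \<rho>: "inj_on \<rho> ?T" "\<rho> ` ?T \<subseteq> {1..n} - V"
    using exists_fresh_injection[of ?T V n] finV cardV n by auto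
  have \<rho>_eq: "\<rho> x = \<rho> y \<longleftrightarrow> x = y" if "x \<in> ?T" "y \<in> ?T" for x y
    using inj_on_eq_iff[OF \<rho>(1) that] .
  have \<rho>_fresh: "\<rho> x \<in> {1..n}" "\<rho> x \<notin> V" if "x \<in> ?T" for x
    using \<rho>(2) that by blast+
  have fV: "f x \<in> V" "f x \<in> {1..n}" if "x \<in> ?\<phi> e" "e \<in> F" for x e
    using c(2)[OF that(2)] core_c(3)[OF that(2)] that unfolding V_def by blast+
  define g where "g x = (if x \<in> I then \<rho> (Inl x) else f x)" for x
  \<comment> \<open>A split edge spends one of its \<open>r - k\<close> expansion vertices on
    \<open>f (w e)\<close>; \<open>k < r\<close> makes the further subtraction of 1 exact.\<close>
  define q where "q e = (if e \<inter> I = {} then r - k else r - k - 1)" for e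
  define Q where "Q e = (\<lambda>i. \<rho> (Inr (e, i))) ` {..<q e}" for e
  define P where "P e = Q e \<union> (if e \<inter> I = {} then {} else {f (w e)})" for e
  have q_less: "i < r" if "i < q e" for i e
    using that unfolding q_def by (auto split: if_splits)
  have old_edge: "x \<in> ?\<phi> e" if "x \<in> e" "x \<notin> I" for x e
    using that unfolding split_edge_def by auto
  have w_edge: "w e \<in> ?\<phi> e" if "e \<inter> I \<noteq> {}" for e
    using that unfolding split_edge_def by auto
  have Q_fresh: "x \<notin> V" "x \<in> {1..n}" if "x \<in> Q e" "e \<in> F" for x e
    using that \<rho>_fresh q_less unfolding Q_def by (auto simp del: atLeastAtMost_iff)
  have Qg: "x \<noteq> g y" if "x \<in> Q e" "e \<in> F" "y \<in> \<Union>F" for x y e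
  proof (cases "y \<in> I")
    case True
    obtain i where "i < q e" "x = \<rho> (Inr (e, i))"
      using \<open>x \<in> Q e\<close> unfolding Q_def by auto
    then show ?thesis
      using True that \<rho>_eq[of "Inr (e, i)" "Inl y"] q_less unfolding g_def by auto
  next
    case False
    obtain e' where "e' \<in> F" "y \<in> e'"
      using \<open>y \<in> \<Union>F\<close> by blast
    then have "f y \<in> V"
      using fV(1) old_edge False by blast
    then show ?thesis
      using Q_fresh(1)[OF that(1,2)] False unfolding g_def by auto
  qed
  \<comment> \<open>Either \<open>g y\<close> is fresh while \<open>f (w e)\<close> lies in
    \<open>V\<close>, or \<open>g y = f y\<close> for an unsplit \<open>y\<close>, which differs
    from \<open>w e\<close>, and \<open>f\<close> is injective.\<close>
  have wg: "f (w e) \<noteq> g y" if "e \<in> F" "e \<inter> I \<noteq> {}" "y \<in> \<Union>F" for e y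
  proof (cases "y \<in> I")
    case True
    have "f (w e) \<in> V"
      using fV(1) w_edge that by blast
    moreover have "\<rho> (Inl y) \<notin> V"
      using \<rho>_fresh(2)[of "Inl y"] that by blast
    ultimately show ?thesis
      using True unfolding g_def by auto
  next
    case False
    then have "y \<in> \<Union>F'"
      using oldF' that(3) by blast
    moreover have "w e \<noteq> y"
      using new[OF that(1,2)] that(3) False by blast
    ultimately show ?thesis
      using inj_onD[OF f(1) _ wF'[OF that(1,2)]] False unfolding g_def by auto
  qed
  have QQ: "Q e \<inter> Q e' = {}" if "e \<in> F" "e' \<in> F" "e \<noteq> e'" for e e'
  proof -
    have "\<rho> (Inr (e, i)) \<noteq> \<rho> (Inr (e', j))" if "i < q e" "j < q e'" for i j
      using \<rho>_eq[of "Inr (e, i)" "Inr (e', j)"] q_less that \<open>e \<in> F\<close> \<open>e' \<in> F\<close> \<open>e \<noteq> e'\<close> by auto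
    then show ?thesis
      unfolding Q_def by auto
  qed
  have wQ: "f (w e) \<notin> Q e'" if "e \<in> F" "e \<inter> I \<noteq> {}" "e' \<in> F" for e e'
    using Q_fresh(1)[OF _ that(3)] fV(1)[OF w_edge[OF that(2)] that(1)] by blast
  have ww: "f (w e) \<noteq> f (w e')"
    if "e \<in> F" "e \<inter> I \<noteq> {}" "e' \<in> F" "e' \<inter> I \<noteq> {}" "e \<noteq> e'" for e e'
  proof -
    have "w e \<noteq> w e'"
      using w that unfolding split_witness_def inj_on_def by blast
    then show ?thesis
      using inj_onD[OF f(1) _ wF'[OF that(1,2)] wF'[OF that(3,4)]] by blast
  qed
  have card_P: "finite (P e) \<and> card (P e) = r - k" if "e \<in> F" for e
  proof -
    have "inj_on (\<lambda>i. \<rho> (Inr (e, i))) {..<q e}"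
      using \<rho>_eq q_less that by (intro inj_onI) auto
    then have "card (Q e) = q e" "finite (Q e)"
      unfolding Q_def by (simp_all add: card_image)
    then show ?thesis
      using wQ[OF that _ that] k(2) unfolding P_def q_def by auto
  qed
  have "inj_on g (\<Union>F)"
  proof (rule inj_onI)
    fix x y assume xy: "x \<in> \<Union>F" "y \<in> \<Union>F" "g x = g y"
    have fresh: "\<rho> (Inl a) \<noteq> f b" if "a \<in> \<Union>F" "b \<in> \<Union>F" "b \<notin> I" for a b
    proof -
      obtain e where "e \<in> F" "b \<in> e"
        using \<open>b \<in> \<Union>F\<close> by blast
      then have "f b \<in> V"
        using fV(1) old_edge that(3) by blast
      moreover have "\<rho> (Inl a) \<notin> V"
        using \<rho>_fresh(2)[of "Inl a"] that(1) by blast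
      ultimately show ?thesis by auto
    qed
    consider "x \<in> I" "y \<in> I" | "x \<in> I" "y \<notin> I" | "x \<notin> I" "y \<in> I" | "x \<notin> I" "y \<notin> I"
      by blast
    then show "x = y"
    proof cases
      case 1
      then show ?thesis
        using xy \<rho>_eq[of "Inl x" "Inl y"] unfolding g_def by auto
    next
      case 2
      then show ?thesis
        using xy fresh[of x y] unfolding g_def by auto
    next
      case 3
      then show ?thesis
        using xy fresh[of y x] unfolding g_def by auto
    next
      case 4
      then have "x \<in> \<Union>F'" "y \<in> \<Union>F'"
        using xy oldF' by blast+
      with 4 xy(3) show ?thesis
        using inj_onD[OF f(1)] unfolding g_def by auto
    qed
  qed
  moreover have "P e \<inter> g ` \<Union>F = {}" if "e \<in> F" for e
    using Qg[OF _ that] wg[OF that] unfolding P_def by (auto split: if_splits)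
  moreover have "P e \<inter> P e' = {}" if "e \<in> F" "e' \<in> F" "e \<noteq> e'" for e e'
    using QQ[OF that] wQ[of e e'] wQ[of e' e] ww[of e e'] that unfolding P_def
    by (simp add: disjoint_iff) metis
  ultimately have emb: "expansion_embedding (r - k) g P F"
    using card_P unfolding expansion_embedding_def by blast
  define B where "B e = g ` e \<union> P e" for e
  \<comment> \<open>The images of the unsplit vertices of \<open>e\<close>, together with
    \<open>f (w e)\<close> if \<open>e\<close> was split, form the core of \<open>c e\<close>. All
    other vertices of \<open>B e\<close> are fresh, so \<open>B e\<close> meets \<open>c e\<close>
    only inside the core.\<close>
  have B_split: "A (c e) \<subseteq> B e \<and> (\<forall>x\<in>B e. x \<in> A (c e) \<or> x \<notin> V \<and> x \<in> {1..n})"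
    if "e \<in> F" for e
  proof
    show "A (c e) \<subseteq> B e"
      unfolding c(2)[OF that, symmetric] B_def split_edge_def P_def g_def by auto
    show "\<forall>x\<in>B e. x \<in> A (c e) \<or> x \<notin> V \<and> x \<in> {1..n}"
    proof
      fix x assume "x \<in> B e"
      then consider y where "y \<in> e" "y \<in> I" "x = \<rho> (Inl y)" | y where "y \<in> e" "y \<notin> I" "x = f y"
        | "x \<in> Q e" | "e \<inter> I \<noteq> {}" "x = f (w e)"
        unfolding B_def P_def g_def by (auto split: if_splits)
      then show "x \<in> A (c e) \<or> x \<notin> V \<and> x \<in> {1..n}"
      proof cases
        case 1
        then show ?thesis
          using \<rho>_fresh[of "Inl y"] that by blast
      next
        case 2
        then show ?thesis
          using old_edge[of y e] c(2)[OF that] by blast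
      next
        case 3
        then show ?thesis
          using Q_fresh[OF _ that] by blast
      next
        case 4
        then show ?thesis
          using w_edge c(2)[OF that] by blast
      qed
    qed
  qed
  have B_mem: "B e \<in> complete_ugraph r n" if "e \<in> F" for e
  proof -
    have "B e \<subseteq> {1..n}"
      using B_split[OF that] core_c(3)[OF that] by blast
    moreover have "card (B e) = r"
      using expansion_embedding_card_edge[OF emb F that] k(2) unfolding B_def by simp
    ultimately show ?thesis
      unfolding complete_ugraph_def by simp
  qed
  have colour: "\<chi> (B e) \<in> \<chi> ` c e" if "e \<in> F" for e
  proof (rule colour_mem[OF c(1)[OF that] B_mem[OF that]])
    show "A (c e) \<subseteq> B e"
      using B_split[OF that] by blast
    have "\<Union>(c e) \<subseteq> V"
      using that unfolding V_def by blast
    then show "B e \<inter> \<Union>(c e) \<subseteq> A (c e)"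
      using B_split[OF that] by blast
  qed
  \<comment> \<open>The colour of \<open>B e\<close> occurs on \<open>c e\<close>, and different
    members share no colour.\<close>
  have "inj_on \<chi> (B ` F)"
  proof (rule inj_onI)
    fix X Y assume "X \<in> B ` F" "Y \<in> B ` F" "\<chi> X = \<chi> Y"
    then obtain a b where ab: "a \<in> F" "X = B a" "b \<in> F" "Y = B b" by blast
    then have "\<chi> X \<in> \<chi> ` c a \<inter> \<chi> ` c b"
      using colour[of a] colour[of b] \<open>\<chi> X = \<chi> Y\<close> by simp
    then have "c a = c b"
      using colours_disjoint[OF c(1)[OF ab(1)] c(1)[OF ab(3)]] by blast
    then show "X = Y"
      using c_neq ab by blast
  qed
  moreover have "B ` F \<subseteq> complete_ugraph r n"
    using B_mem by blast
  moreover have "copy_of (expansion r k F) (B ` F)"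
    using expansion_embedding_imp_copy_of[OF emb] unfolding B_def .
  ultimately show False
    using no_rainbow_copy by blast
qed

end

section \<open>Maximal packings and the anti-Ramsey bound\<close>

lemma card_copy_expansion_le:
  assumes "copy_of (expansion r k F) C" "finite F"
  shows "card C \<le> card F"
proof -
  obtain g P where "C = (\<lambda>e. g ` e \<union> P e) ` F"
    using copy_of_imp_expansion_embedding[OF assms(1)] by metis
  then show ?thesis
    using card_image_le[OF assms(2)] by simp
qed

lemma ar_le:
  assumes "1 \<le> m"
    and "\<And>\<chi> :: nat set \<Rightarrow> nat. \<chi> ` complete_ugraph r n = {1..m} \<Longrightarrow> \<not> rainbow_free r n \<chi> {F}"
  shows "ar r n F \<le> m"
proof -
  have "\<exists>G\<subseteq>complete_ugraph r n. rainbow \<chi> G \<and> copy_of F G"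
    if \<chi>: "\<chi> ` complete_ugraph r n = {1..m}" for \<chi>
  proof -
    obtain H G where "H \<subseteq> complete_ugraph r n" "rainbow \<chi> H" "G \<subseteq> H" "copy_of F G"
      using assms(2)[OF \<chi>] unfolding rainbow_free_def free_of_def by blast
    moreover from this have "rainbow \<chi> G"
      unfolding rainbow_def using inj_on_subset by blast
    ultimately show ?thesis by blast
  qed
  with assms(1) show ?thesis
    unfolding ar_def by (intro Least_le) blast
qed

text \<open>The set \<open>S\<close> consists of all edges of a maximal packing. The threshold for
  \<open>n\<close> covers at once the room needed by \<open>missing_edge_core\<close>,
  \<open>core_inj\<close> and \<open>cores_Split_free\<close>, and the \<open>r + k\<close> needed
  to enlarge a single core.\<close>

lemma rainbow_removal:
  fixes F :: "'a::infinite set set"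
  assumes k: "2 \<le> k" "k < r" and F: "ugraph k F"
    and n: "card F * (card F * r) + 2 * (card F * r) + card F * k + card (\<Union>F) + r + k \<le> n"
    and \<chi>: "rainbow_free r n \<chi> {expansion r k F}"
    and H: "H \<subseteq> complete_ugraph r n" "rainbow \<chi> H"
  shows "\<exists>S\<subseteq>H. int (card S) \<le> (int (card F) - 1) * int (ex_num k n (Split k F)) \<and>
    free_of (expansion r k ` remove_one_edge F) (H - S)"
proof -
  have finF: "finite F" and finH: "finite H"
    using ugraph_finite(1)[OF F] finite_subset[OF H(1) finite_complete_ugraph] .
  \<comment> \<open>The empty graph is rainbow, and it is a copy of the expansion of an edgeless
    \<open>F\<close>; so \<open>F\<close> has an edge and \<open>card F - 1\<close> is an honest
    difference.\<close>
  have "\<not> copy_of (expansion r k F) ({} :: nat set set)"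
    using \<chi> unfolding rainbow_free_def free_of_def rainbow_def
    by auto
  then have "F \<noteq> {}"
    by (auto simp: copy_of_def expansion_def)
  define near where "near C \<longleftrightarrow> C \<subseteq> H \<and> (\<exists>e\<in>F. copy_of (expansion r k (F - {e})) C)" for C
  have near_card: "card C \<le> card F - 1" if "near C" for C
  proof -
    obtain e where "e \<in> F" "copy_of (expansion r k (F - {e})) C"
      using \<open>near C\<close> unfolding near_def by blast
    then show ?thesis
      using card_copy_expansion_le[of r k "F - {e}" C] finF by simp
  qed
  have "\<exists>A. A \<in> complete_ugraph k n \<and>
      (\<forall>B\<in>complete_ugraph r n. A \<subseteq> B \<longrightarrow> B \<inter> \<Union>C \<subseteq> A \<longrightarrow> copy_of (expansion r k F) (insert B C))"
    if "near C" for C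
  proof -
    obtain e where e: "e \<in> F" "copy_of (expansion r k (F - {e})) C" and C: "C \<subseteq> complete_ugraph r n"
      using \<open>near C\<close> H(1) unfolding near_def by blast
    have "card (\<Union>C) \<le> card C * r"
      by (rule card_Union_le[OF C])
    also have "\<dots> \<le> card F * r"
      using near_card[OF that] by (intro mult_le_mono1) simp
    finally have "k + card (\<Union>C) \<le> n"
      using n by linarith
    from missing_edge_core[OF F e C this] show ?thesis
      by metis
  qed
  then obtain A where A: "\<And>C. near C \<Longrightarrow> A C \<in> complete_ugraph k n"
    "\<And>C B. near C \<Longrightarrow> B \<in> complete_ugraph r n \<Longrightarrow> A C \<subseteq> B \<Longrightarrow> B \<inter> \<Union>C \<subseteq> A C \<Longrightarrow>
       copy_of (expansion r k F) (insert B C)"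
    by metis
  define packing where "packing \<C> \<longleftrightarrow>
    (\<forall>C\<in>\<C>. near C) \<and> (\<forall>C\<in>\<C>. \<forall>D\<in>\<C>. C \<noteq> D \<longrightarrow> C \<inter> D = {})" for \<C>
  \<comment> \<open>Packings lie in a finite power set and the empty one qualifies, so an
    inclusion-maximal packing exists.\<close>
  have "{\<C>. packing \<C>} \<subseteq> Pow (Pow H)"
    unfolding packing_def near_def by blast
  then have "finite {\<C>. packing \<C>}"
    using finH finite_subset by blast
  moreover have "{} \<in> {\<C>. packing \<C>}"
    unfolding packing_def by blast
  ultimately obtain \<C> where \<C>: "packing \<C>" "\<And>\<D>. packing \<D> \<Longrightarrow> \<C> \<subseteq> \<D> \<Longrightarrow> \<D> = \<C>"
    using finite_has_maximal2[of "{\<C>. packing \<C>}" "{}"] by auto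
  have near: "near C" if "C \<in> \<C>" for C
    using \<C>(1) that unfolding packing_def by blast
  interpret rainbow_packing r k n F \<chi> H \<C> A
  proof
    show "C \<subseteq> H" if "C \<in> \<C>" for C
      using near[OF that] unfolding near_def by blast
    show "card C \<le> card F" if "C \<in> \<C>" for C
      using near_card[OF near[OF that]] by simp
    show "A C \<in> complete_ugraph k n" if "C \<in> \<C>" for C
      using A(1)[OF near[OF that]] .
    show "C \<inter> D = {}" if "C \<in> \<C>" "D \<in> \<C>" "C \<noteq> D" for C D
      using \<C>(1) that unfolding packing_def by blast
    show "copy_of (expansion r k F) (insert B C)"
      if "C \<in> \<C>" "B \<in> complete_ugraph r n" "A C \<subseteq> B" "B \<inter> \<Union>C \<subseteq> A C" for C B
      using A(2)[OF near[OF that(1)] that(2-4)] .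
  qed (use k F \<chi> H in \<open>auto simp: rainbow_def\<close>)
  \<comment> \<open>An empty copy could arise only if \<open>F\<close> had a single edge, but then
    any one edge containing the core would be a rainbow copy of the expansion. Nonemptiness is what
    makes maximality contradictory at the end.\<close>
  have nonempty: "C \<noteq> {}" if "near C" for C
  proof
    assume "C = {}"
    have "A C \<in> complete_ugraph k n"
      using A(1)[OF that] .
    then have "finite (A C)" "A C \<subseteq> {1..n}" "card (A C) = k"
      using finite_subset[of "A C" "{1..n}"] unfolding complete_ugraph_def by auto
    then obtain B where B: "A C \<subseteq> B" "B \<subseteq> {1..n}" "card B = r"
      using exists_fresh_superset[of "A C" "A C" n r] n k by auto
    then have "B \<in> complete_ugraph r n"
      unfolding complete_ugraph_def by simp
    with A(2)[OF that this B(1)] no_rainbow_copy[of "{B}"] \<open>C = {}\<close> show False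
      by simp
  qed
  have "card (A ` \<C>) \<le> ex_num k n (Split k F)"
  proof (rule card_le_ex_num)
    show "A ` \<C> \<subseteq> complete_ugraph k n"
      using core by blast
    show "free_of (Split k F) (A ` \<C>)"
      by (rule cores_Split_free) (use n in linarith)
  qed
  moreover have "card (A ` \<C>) = card \<C>"
    by (rule card_image[OF core_inj]) (use n in linarith)
  ultimately have card_\<C>: "card \<C> \<le> ex_num k n (Split k F)"
    by simp
  show ?thesis
  proof (intro exI conjI)
    show "\<Union>\<C> \<subseteq> H"
      using sub by blast
    have "card (\<Union>\<C>) \<le> (\<Sum>C\<in>\<C>. card C)"
      by (rule card_Union_le_sum_card)
    also have "\<dots> \<le> card \<C> * (card F - 1)"
      using sum_bounded_above[of \<C> card "card F - 1"] near_card near by simp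
    also have "\<dots> \<le> (card F - 1) * ex_num k n (Split k F)"
      using card_\<C> by (simp add: mult.commute)
    finally have "int (card (\<Union>\<C>)) \<le> int ((card F - 1) * ex_num k n (Split k F))"
      by (simp only: of_nat_le_iff)
    moreover have "1 \<le> card F"
      using \<open>F \<noteq> {}\<close> finF by (simp add: Suc_leI card_gt_0_iff)
    ultimately show "int (card (\<Union>\<C>)) \<le> (int (card F) - 1) * int (ex_num k n (Split k F))"
      by (simp add: of_nat_diff)
    show "free_of (expansion r k ` remove_one_edge F) (H - \<Union>\<C>)"
      unfolding free_of_def
    proof (intro ballI notI)
      fix E assume "E \<in> expansion r k ` remove_one_edge F" "\<exists>C\<subseteq>H - \<Union>\<C>. copy_of E C"
      then obtain C where C: "C \<subseteq> H - \<Union>\<C>" "near C"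
        unfolding remove_one_edge_def near_def by blast
      \<comment> \<open>A copy surviving the removal is edge-disjoint from every member; maximality
        then makes it a member, although it avoids its own edges.\<close>
      then have "packing (insert C \<C>)"
        using \<C>(1) unfolding packing_def by blast
      then have "C \<in> \<C>"
        using \<C>(2) by blast
      with C nonempty[OF C(2)] show False
        by blast
    qed
  qed
qed

theorem theorem1p1:
  fixes r k :: nat and F :: "'a::infinite set set"
  assumes "2 \<le> k" and "k < r" and "ugraph k F"
  shows "\<exists>n\<^sub>0. \<forall>n\<ge>n\<^sub>0.
    (\<forall>\<chi> :: nat set \<Rightarrow> nat. rainbow_free r n \<chi> {expansion r k F} \<longrightarrow>
      (\<forall>H\<subseteq>complete_ugraph r n. rainbow \<chi> H \<longrightarrow>
        (\<exists>S\<subseteq>H. int (card S) \<le> (int (card F) - 1) * int (ex_num k n (Split k F)) \<and>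
           free_of (expansion r k ` remove_one_edge F) (H - S)))) \<and>
    int (ar r n (expansion r k F)) \<le>
      int (ex_num r n (expansion r k ` remove_one_edge F)) +
      (int (card F) - 1) * int (ex_num k n (Split k F)) + 1"
proof (rule exI, intro allI impI, rule conjI)
  fix n assume n: "card F * (card F * r) + 2 * (card F * r) + card F * k + card (\<Union>F) + r + k \<le> n"
  note removal = rainbow_removal[OF assms n]
  show "\<forall>\<chi> :: nat set \<Rightarrow> nat. rainbow_free r n \<chi> {expansion r k F} \<longrightarrow>
      (\<forall>H\<subseteq>complete_ugraph r n. rainbow \<chi> H \<longrightarrow>
        (\<exists>S\<subseteq>H. int (card S) \<le> (int (card F) - 1) * int (ex_num k n (Split k F)) \<and>
           free_of (expansion r k ` remove_one_edge F) (H - S)))"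
    using removal by blast
  define t where "t = (int (card F) - 1) * int (ex_num k n (Split k F))"
  \<comment> \<open>For edgeless \<open>F\<close> the first factor is -1. In that case no graph is
    free of \<open>Split k F\<close>, and the supremum of the empty set makes the second factor
    0.\<close>
  have "0 \<le> t"
  proof (cases "F = {}")
    case True
    have "F \<in> Split k F"
      unfolding Split_def using True by (auto intro!: exI[of _ "[]"] simp: independent_def)
    moreover have "copy_of F {}"
      using True unfolding copy_of_def by simp
    ultimately have "\<not> free_of (Split k F) G" for G :: "nat set set"
      unfolding free_of_def by blast
    then have "ex_num k n (Split k F) = 0"
      unfolding ex_num_def by simp
    then show ?thesis
      unfolding t_def by simp
  next
    case False
    then have "1 \<le> card F"
      using ugraph_finite[OF assms(3)] by (simp add: Suc_leI card_gt_0_iff)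
    then show ?thesis
      unfolding t_def by simp
  qed
  define m where "m = ex_num r n (expansion r k ` remove_one_edge F) + nat t + 1"
  have "ar r n (expansion r k F) \<le> m"
  proof (rule ar_le)
    show "1 \<le> m"
      unfolding m_def by simp
    fix \<chi> :: "nat set \<Rightarrow> nat" assume \<chi>: "\<chi> ` complete_ugraph r n = {1..m}"
    show "\<not> rainbow_free r n \<chi> {expansion r k F}"
    proof
      assume free: "rainbow_free r n \<chi> {expansion r k F}"
      \<comment> \<open>One edge is chosen from each colour class, giving a rainbow graph with
        exactly \<open>m\<close> edges.\<close>
      obtain H where H: "H \<subseteq> complete_ugraph r n" "inj_on \<chi> H" "\<chi> ` complete_ugraph r n = \<chi> ` H"
        using subset_image_inj[of "\<chi> ` complete_ugraph r n" \<chi> "complete_ugraph r n"] by auto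
      have card_H: "card H = m"
        using card_image[OF H(2)] unfolding H(3)[symmetric] \<chi> by simp
      obtain S where S: "S \<subseteq> H" "int (card S) \<le> t"
        "free_of (expansion r k ` remove_one_edge F) (H - S)"
        using removal[OF free H(1)] H(2) unfolding t_def rainbow_def by blast
      \<comment> \<open>Deleting at most \<open>t\<close> of the \<open>m\<close> edges leaves at
        least one more than the extremal number, by the final \<open>+ 1\<close> in
        \<open>m\<close>.\<close>
      have "card (H - S) \<le> ex_num r n (expansion r k ` remove_one_edge F)"
        by (rule card_le_ex_num[OF _ S(3)]) (use H(1) in blast)
      moreover have "card (H - S) = m - card S"
        using card_Diff_subset[OF _ S(1)] card_H S(1) H(1) finite_complete_ugraph
        by (metis finite_subset)
      ultimately show False
        using S(2) \<open>0 \<le> t\<close> unfolding m_def by linarith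
    qed
  qed
  then show "int (ar r n (expansion r k F)) \<le>
      int (ex_num r n (expansion r k ` remove_one_edge F)) +
      (int (card F) - 1) * int (ex_num k n (Split k F)) + 1"
    using \<open>0 \<le> t\<close> unfolding m_def t_def[symmetric] by linarith
qed

end
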